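(* Let $q$ be a prime power. There exists a value $k\in\mathbb{F}_q$ such that the polynomial $x^7 + kx^3 - 1\in\mathbb{F}_q[x]$ has no zeros in $\mathbb{F}_q$. *)

theory Defs
  imports
    "HOL-Library.Cardinality"
    "HOL-Computational_Algebra.Polynomial"
    "HOL-Number_Theory.Prime_Powers"
begin

end

theory Submission
  imports Defs
begin

text \<open>
  At \<open>x = 0\<close> the polynomial takes the value \<open>-1\<close>, and a nonzero \<open>x\<close> is a zero for exactly one
  value of \<open>k\<close>, because the equation \<open>x\<^sup>7 + k x\<^sup>3 = 1\<close> is linear in \<open>k\<close>.  So the bad values of \<open>k\<close>
  number at most \<open>q - 1\<close>, and one of the \<open>q\<close> elements of the field is not bad.
\<close>

theorem proposition1p3:
  fixes q :: nat
  assumes "primepow q"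
    and "CARD('a :: {field, finite}) = q"
  shows "\<exists>k :: 'a. \<forall>x :: 'a. poly (monom 1 7 + monom k 3 - 1) x \<noteq> 0"
proof -
  let ?bad = "(\<lambda>x::'a. (1 - x ^ 7) / x ^ 3) ` (UNIV - {0})"
  have "card ?bad \<le> card (UNIV - {0::'a})"
    by (rule card_image_le) simp
  also have "\<dots> < CARD('a)"
    by (rule psubset_card_mono) auto
  finally have "?bad \<noteq> UNIV"
    by auto
  then obtain k where k: "k \<notin> ?bad"
    by blast
  have "poly (monom 1 7 + monom k 3 - 1) x \<noteq> 0" for x
  proof (cases "x = 0")
    case True
    then show ?thesis
      by (simp add: poly_monom)
  next
    case False
    then have "k \<noteq> (1 - x ^ 7) / x ^ 3"
      using k by blast
    with False have "k * x ^ 3 \<noteq> 1 - x ^ 7"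
      by (simp add: eq_divide_eq)
    then show ?thesis
      by (simp add: poly_monom eq_diff_eq add.commute)
  qed
  then show ?thesis
    by blast
qed

end
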